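(* Let $A$ be any ordered finite set of positive integers and let $\tau$ be a consecutive pattern (a segmented partially ordered pattern, possibly with repeated letters). Then $$\sum_{n,m\geq0}\ \sum_{\sigma\in C_{n;m}^A} t^{\tau\text{-nlap}(\sigma)}x^ny^m=\frac{C_\tau^A(x,y)}{1-t\left[\left(y\sum_{a\in A}x^a-1\right)C_\tau^A(x,y)+1\right]},$$ where $\tau\text{-nlap}(\sigma)$ is the maximum number of non-overlapping occurrences of $\tau$ in $\sigma$.
   Context: A composition $\sigma=\sigma_1\ldots\sigma_m$ of $n$ with $m$ parts in $A$ is a sequence of $m$ elements of $A$ with sum $n$; the set of these is $C_{n;m}^A$. The empty composition ($n=m=0$) is included. A segmented partially ordered pattern is a (non-empty) word $\tau=\tau_1\ldots\tau_r$, without dashes, of letters from a partially ordered alphabet, with repeated letters allowed; in particular, $\tau$ may be a word over the totally ordered alphabet $[\ell]=\{1,\dots,\ell\}$ containing each letter of $[\ell]$. An occurrence of $\tau$ in $\sigma$ is a factor $\sigma_{i+1}\ldots\sigma_{i+r}$ of $r$ consecutive parts such that $\sigma_{i+p}=\sigma_{i+q}$ whenever $\tau_p=\tau_q$ and $\sigma_{i+p}<\sigma_{i+q}$ whenever $\tau_p<\tau_q$ (no condition for incomparable letters). $\sigma$ avoids $\tau$ if it has no occurrence of $\tau$; $C_{n;m}^A(\tau)$ is the set of $\sigma\in C_{n;m}^A$ avoiding $\tau$, and $C_\tau^A(x,y)=\sum_{n,m\ge0}|C_{n;m}^A(\tau)|x^ny^m$. Two occurrences of $\tau$ overlap in a composition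 if they contain any of the same letters (i.e. share a position) of the composition; $\tau\text{-nlap}(\sigma)$ is the largest size of a set of pairwise non-overlapping occurrences of $\tau$ in $\sigma$. *)

theory Defs
  imports "HOL-Computational_Algebra.Formal_Power_Series"
begin

definition compositions :: "nat set \<Rightarrow> nat \<Rightarrow> nat \<Rightarrow> nat list set" where
  "compositions A n m = {\<sigma>. set \<sigma> \<subseteq> A \<and> length \<sigma> = m \<and> sum_list \<sigma> = n}"

text \<open>
  A segmented partially ordered pattern is a non-empty list over a type of class \<^class>\<open>order\<close>.
  An occurrence of \<open>\<tau>\<close> is identified with its (0-based) starting position \<open>i\<close>, so that it
  occupies the positions \<open>{i..<i + length \<tau>}\<close> of the composition.
\<close>

definition occurs_at :: "'p::order list \<Rightarrow> nat list \<Rightarrow> nat \<Rightarrow> bool" where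
  "occurs_at \<tau> \<sigma> i \<longleftrightarrow>
     i + length \<tau> \<le> length \<sigma> \<and>
     (\<forall>p<length \<tau>. \<forall>q<length \<tau>.
        (\<tau> ! p = \<tau> ! q \<longrightarrow> \<sigma> ! (i + p) = \<sigma> ! (i + q)) \<and>
        (\<tau> ! p < \<tau> ! q \<longrightarrow> \<sigma> ! (i + p) < \<sigma> ! (i + q)))"

definition avoids :: "nat list \<Rightarrow> 'p::order list \<Rightarrow> bool" where
  "avoids \<sigma> \<tau> \<longleftrightarrow> (\<nexists>i. occurs_at \<tau> \<sigma> i)"

definition nonoverlapping :: "'p list \<Rightarrow> nat \<Rightarrow> nat \<Rightarrow> bool" where
  "nonoverlapping \<tau> i j \<longleftrightarrow> {i..<i + length \<tau>} \<inter> {j..<j + length \<tau>} = {}"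

definition nlap :: "'p::order list \<Rightarrow> nat list \<Rightarrow> nat" where
  "nlap \<tau> \<sigma> = Max {card S |S. S \<subseteq> {i. occurs_at \<tau> \<sigma> i} \<and> pairwise (nonoverlapping \<tau>) S}"

text \<open>
  Power series in \<open>x, y, t\<close> with rational coefficients are nested univariate series: the outermost
  variable is \<open>x\<close>, the next one \<open>y\<close>, the innermost one \<open>t\<close>.
\<close>

type_synonym fps_xyt = "rat fps fps fps"

definition X :: fps_xyt where "X = fps_X"
definition Y :: fps_xyt where "Y = fps_const fps_X"
definition T :: fps_xyt where "T = fps_const (fps_const fps_X)"

definition avoiding_gf :: "nat set \<Rightarrow> 'p::order list \<Rightarrow> fps_xyt" where
  "avoiding_gf A \<tau> =
     Abs_fps (\<lambda>n. Abs_fps (\<lambda>m. of_nat (card {\<sigma> \<in> compositions A n m. avoids \<sigma> \<tau>})))"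

definition nlap_gf :: "nat set \<Rightarrow> 'p::order list \<Rightarrow> fps_xyt" where
  "nlap_gf A \<tau> =
     Abs_fps (\<lambda>n. Abs_fps (\<lambda>m. \<Sum>\<sigma>\<in>compositions A n m. fps_X ^ nlap \<tau> \<sigma>))"

text \<open>
  Over coefficients that do not form a field, \<open>/\<close> on power series is not a priori an exact quotient.
  It is one when the constant coefficient of the divisor is 1, as the second lemma shows.
  In the denominator \<open>1 - t ((y \<Sum>x^a - 1) C + 1)\<close> the coefficient of \<open>x^0\<close> is indeed 1,
  since for positive parts \<open>C\<close> has the coefficient 1 there.
\<close>

lemma inverse_one_fps_xyt: "inverse (1 :: rat fps fps) = 1"
proof -
  have 1: "inverse (1 :: rat fps) = 1" by simp
  have "(1 :: rat fps fps) * inverse 1 = 1"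
    unfolding fps_inverse_def using 1
    by (intro fps_right_inverse) simp
  then show ?thesis by simp
qed

lemma fps_xyt_divide_exact:
  fixes f g :: fps_xyt
  assumes "fps_nth g 0 = 1"
  shows "f / g * g = f"
proof -
  have "g * inverse g = 1"
    unfolding fps_inverse_def using assms inverse_one_fps_xyt
    by (intro fps_right_inverse) simp
  moreover have "f / g = f * inverse g"
    using assms by (intro fps_divide_unit) simp
  ultimately show ?thesis
    by (simp add: mult.assoc mult.commute[of "inverse g"])
qed

end

theory Submission
  imports Defs
begin

text \<open>
  Write \<open>C\<close> for the series of the words over \<open>A\<close> that avoid \<open>\<tau>\<close>, \<open>F\<close> for the left-hand side and
  \<open>P = \<Sum>a\<in>A. x^a\<close>.  The auxiliary object is the language of \<^emph>\<open>first-hit words\<close>: words that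
  contain \<open>\<tau>\<close> but lose it when the last letter is dropped, so that the only occurrence of \<open>\<tau>\<close> sits
  at the very end.  Let \<open>D\<close> be their series.

  Appending one letter to an avoiding word gives either a nonempty avoiding word or a first-hit word,
  each exactly once.  Hence \<open>C y P = (C - 1) + D\<close>, that is \<open>D = (y P - 1) C + 1\<close>, which is the bracket
  in the theorem (\<open>gf_first_hit\<close>).

  Reading a word from the left until \<open>\<tau>\<close> shows up for the first time, either it never does, or the
  word factors uniquely as \<open>u @ v\<close> with \<open>u\<close> a first-hit word and \<open>v\<close> arbitrary.  Choosing
  the occurrence that ends first is optimal when packing disjoint occurrences, so \<open>u\<close> accounts for
  exactly one of them: \<open>nlap (u @ v) = 1 + nlap v\<close> (\<open>nlap_first_hit_append\<close>).
  Hence \<open>F = C + t D F\<close>, and the theorem follows by solving for \<open>F\<close>.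

  Both identities between series are read off from identities between languages: disjoint unions
  become sums and unambiguous concatenations become products (\<open>gf_concat\<close>).
\<close>

unbundle fps_syntax

section \<open>Generating functions of languages\<close>

text \<open>
  Weights with values in the innermost coefficient ring allow the avoiding words (weight 1) and the
  statistic \<open>t^nlap\<close> to be treated alike.
\<close>

definition words :: "nat set \<Rightarrow> nat list set \<Rightarrow> nat \<Rightarrow> nat \<Rightarrow> nat list set" where
  "words A L n m = compositions A n m \<inter> L"

definition gf :: "nat set \<Rightarrow> nat list set \<Rightarrow> (nat list \<Rightarrow> rat fps) \<Rightarrow> fps_xyt" where
  "gf A L w = Abs_fps (\<lambda>n. Abs_fps (\<lambda>m. \<Sum>\<sigma>\<in>words A L n m. w \<sigma>))"

lemma fps_xyt_ext:
  fixes f g :: fps_xyt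
  assumes "\<And>n m. f $ n $ m = g $ n $ m"
  shows "f = g"
  using assms by (intro fps_ext[of f g] fps_ext[of "f $ n" "g $ n" for n])

lemma gf_nth: "gf A L w $ n $ m = (\<Sum>\<sigma>\<in>words A L n m. w \<sigma>)"
  by (simp add: gf_def)

lemma finite_words:
  assumes "finite A"
  shows "finite (words A L n m)"
  by (rule finite_subset[OF _ finite_lists_length_eq[OF assms, of m]])
    (auto simp: words_def compositions_def)

lemma gf_cong:
  assumes "\<And>\<sigma>. \<sigma> \<in> L \<Longrightarrow> w \<sigma> = w' \<sigma>"
  shows "gf A L w = gf A L w'"
  by (intro fps_xyt_ext) (auto simp: gf_nth words_def assms intro!: sum.cong)

lemma gf_Un_disjoint:
  assumes "finite A" "L1 \<inter> L2 = {}"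
  shows "gf A (L1 \<union> L2) w = gf A L1 w + gf A L2 w"
proof -
  have "words A (L1 \<union> L2) n m = words A L1 n m \<union> words A L2 n m" for n m
    by (auto simp: words_def)
  moreover have "words A L1 n m \<inter> words A L2 n m = {}" for n m
    using assms(2) by (auto simp: words_def)
  ultimately show ?thesis
    using finite_words[OF assms(1)]
    by (intro fps_xyt_ext) (simp add: gf_nth sum.union_disjoint)
qed

lemma gf_scale: "gf A L (\<lambda>\<sigma>. c * w \<sigma>) = fps_const (fps_const c) * gf A L w"
  by (intro fps_xyt_ext) (simp add: gf_nth sum_distrib_left)

lemma gf_empty_word: "gf A {[]} (\<lambda>_. 1) = 1"
proof -
  have "words A {[]} n m = (if n = 0 \<and> m = 0 then {[]} else {})" for n m
    by (auto simp: words_def compositions_def)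
  then show ?thesis
    by (intro fps_xyt_ext) (simp add: gf_nth fps_one_nth)
qed

lemma gf_letters:
  assumes "finite A"
  shows "gf A {\<sigma>. length \<sigma> = 1} (\<lambda>_. 1) = Y * (\<Sum>a\<in>A. X ^ a)"
proof (rule fps_xyt_ext)
  fix n m
  have "words A {\<sigma>. length \<sigma> = 1} n m = (if m = 1 \<and> n \<in> A then {[n]} else {})"
    by (auto simp: words_def compositions_def length_Suc_conv)
  then have "gf A {\<sigma>. length \<sigma> = 1} (\<lambda>_. 1) $ n $ m = (if m = 1 \<and> n \<in> A then 1 else 0)"
    by (simp add: gf_nth)
  also have "\<dots> = (Y * (\<Sum>a\<in>A. X ^ a)) $ n $ m"
    using assms by (simp add: Y_def X_def fps_sum_nth fps_X_power_nth)
  finally show "gf A {\<sigma>. length \<sigma> = 1} (\<lambda>_. 1) $ n $ m = (Y * (\<Sum>a\<in>A. X ^ a)) $ n $ m" .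
qed

text \<open>
  Injectivity of concatenation on \<open>L1 \<times> L2\<close> says that every word of the product language has only
  one factorization, so the Cauchy product counts no word twice.
\<close>

lemma gf_concat:
  assumes "finite A"
    and inj: "inj_on (\<lambda>(u, v). u @ v) (L1 \<times> L2)"
    and w: "\<And>u v. u \<in> L1 \<Longrightarrow> v \<in> L2 \<Longrightarrow> w (u @ v) = w1 u * w2 v"
  shows "gf A ((\<lambda>(u, v). u @ v) ` (L1 \<times> L2)) w = gf A L1 w1 * gf A L2 w2"
proof (rule fps_xyt_ext)
  fix n m :: nat
  define I where "I = {0..n} \<times> {0..m}"
  \<comment> \<open>The Cauchy product splits the sum over factorizations by size and length of the left factor.\<close>
  define Q where "Q = (\<lambda>(i, j). words A L1 i j \<times> words A L2 (n - i) (m - j))"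
  have finI: "finite I" by (simp add: I_def)
  have finQ: "finite (Q p)" for p
    using finite_words[OF assms(1)] by (cases p) (simp add: Q_def)
  have disj: "Q p \<inter> Q q = {}" if "p \<noteq> q" for p q
    using that by (cases p; cases q) (auto simp: Q_def words_def compositions_def)
  have img: "words A ((\<lambda>(u, v). u @ v) ` (L1 \<times> L2)) n m = (\<lambda>(u, v). u @ v) ` (\<Union>p\<in>I. Q p)"
    (is "?W = ?R")
  proof
    show "?W \<subseteq> ?R"
    proof
      fix \<sigma> assume "\<sigma> \<in> ?W"
      then obtain u v where uv: "\<sigma> = u @ v" "u \<in> L1" "v \<in> L2" and c: "u @ v \<in> compositions A n m"
        by (auto simp: words_def)
      from c uv have "(u, v) \<in> Q (sum_list u, length u)" "(sum_list u, length u) \<in> I"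
        by (auto simp: Q_def I_def words_def compositions_def)
      then show "\<sigma> \<in> ?R" using uv(1) by force
    qed
    show "?R \<subseteq> ?W"
      by (auto simp: Q_def I_def words_def compositions_def)
  qed
  have sub: "(\<Union>p\<in>I. Q p) \<subseteq> L1 \<times> L2"
    by (auto simp: Q_def words_def)
  have "gf A ((\<lambda>(u, v). u @ v) ` (L1 \<times> L2)) w $ n $ m = (\<Sum>(u, v)\<in>(\<Union>p\<in>I. Q p). w (u @ v))"
    unfolding gf_nth img
    by (subst sum.reindex[OF inj_on_subset[OF inj sub]]) (simp add: case_prod_unfold)
  also have "\<dots> = (\<Sum>(u, v)\<in>(\<Union>p\<in>I. Q p). w1 u * w2 v)"
    using sub w by (intro sum.cong) auto
  also have "\<dots> = (\<Sum>p\<in>I. \<Sum>(u, v)\<in>Q p. w1 u * w2 v)"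
    using finI finQ disj by (intro sum.UNION_disjoint) auto
  also have "\<dots> = (\<Sum>(i, j)\<in>I. gf A L1 w1 $ i $ j * gf A L2 w2 $ (n - i) $ (m - j))"
    by (intro sum.cong)
      (auto simp: Q_def gf_nth sum_product sum.cartesian_product)
  also have "\<dots> = (gf A L1 w1 * gf A L2 w2) $ n $ m"
    by (simp add: I_def fps_mult_nth fps_sum_nth sum.cartesian_product)
  finally show "gf A ((\<lambda>(u, v). u @ v) ` (L1 \<times> L2)) w $ n $ m = (gf A L1 w1 * gf A L2 w2) $ n $ m" .
qed

section \<open>Occurrences and first-hit words\<close>

lemma occurs_at_append_left:
  assumes "i + length \<tau> \<le> length u"
  shows "occurs_at \<tau> (u @ v) i \<longleftrightarrow> occurs_at \<tau> u i"
  using assms by (auto simp: occurs_at_def nth_append)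

lemma occurs_at_append_right: "occurs_at \<tau> (u @ v) (length u + i) \<longleftrightarrow> occurs_at \<tau> v i"
  by (simp add: occurs_at_def nth_append add.assoc)

lemma occurs_at_le: "occurs_at \<tau> \<sigma> i \<Longrightarrow> i + length \<tau> \<le> length \<sigma>"
  by (simp add: occurs_at_def)

lemma avoids_prefix: "avoids (u @ v) \<tau> \<Longrightarrow> avoids u \<tau>"
  unfolding avoids_def using occurs_at_append_left occurs_at_le by blast

lemma avoids_Nil: "\<tau> \<noteq> [] \<Longrightarrow> avoids [] \<tau>"
  by (auto simp: avoids_def occurs_at_def)

definition first_hit :: "'p::order list \<Rightarrow> nat list set" where
  "first_hit \<tau> = {\<sigma>. \<not> avoids \<sigma> \<tau> \<and> avoids (butlast \<sigma>) \<tau>}"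

text \<open>An occurrence that ended earlier would survive dropping the last letter.\<close>

lemma first_hit_occurrence_end:
  assumes "u \<in> first_hit \<tau>" "occurs_at \<tau> (u @ v) i"
  shows "length u \<le> i + length \<tau>"
proof (rule ccontr)
  assume "\<not> length u \<le> i + length \<tau>"
  then have le: "i + length \<tau> \<le> length (butlast u)" and "u \<noteq> []" by auto
  then have "u @ v = butlast u @ (last u # v)" by simp
  then have "occurs_at \<tau> (butlast u) i"
    using assms(2) occurs_at_append_left[OF le] by metis
  then show False using assms(1) by (auto simp: first_hit_def avoids_def)
qed

lemma first_hit_occurs_at_end:
  assumes "u \<in> first_hit \<tau>"
  obtains i where "occurs_at \<tau> u i" "i + length \<tau> = length u"
proof -
  obtain i where i: "occurs_at \<tau> u i"
    using assms by (auto simp: first_hit_def avoids_def)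
  moreover have "length u \<le> i + length \<tau>"
    using first_hit_occurrence_end[of u \<tau> "[]"] assms i by simp
  ultimately show thesis using that occurs_at_le[OF i] by simp
qed

text \<open>
  First-hit words form a prefix code: a proper prefix of such a word is a prefix of its \<open>butlast\<close>, and
  therefore avoids \<open>\<tau>\<close>.
\<close>

lemma first_hit_prefix_eq:
  assumes "u \<in> first_hit \<tau>" "u @ z \<in> first_hit \<tau>"
  shows "z = []"
proof (rule ccontr)
  assume "z \<noteq> []"
  then have "avoids (u @ butlast z) \<tau>"
    using assms(2) by (simp add: first_hit_def butlast_append)
  then have "avoids u \<tau>" by (rule avoids_prefix)
  then show False using assms(1) by (simp add: first_hit_def)
qed

lemma inj_on_first_hit_append: "inj_on (\<lambda>(u, v). u @ v) (first_hit \<tau> \<times> UNIV)"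
proof (rule inj_onI, clarify)
  fix u v u' v'
  assume u: "u \<in> first_hit \<tau>" "u' \<in> first_hit \<tau>" and "u @ v = u' @ v'"
  then obtain z where "u = u' @ z \<and> z @ v = v' \<or> u @ z = u' \<and> v = z @ v'"
    by (auto simp: append_eq_append_conv2)
  then show "u = u' \<and> v = v'" using u first_hit_prefix_eq by fastforce
qed

lemma obtain_first_hit_prefix:
  assumes "\<tau> \<noteq> []" "\<not> avoids \<sigma> \<tau>"
  obtains u v where "\<sigma> = u @ v" "u \<in> first_hit \<tau>"
proof -
  have "\<exists>u v. \<sigma> = u @ v \<and> u \<in> first_hit \<tau>"
    using assms(2)
  proof (induction \<sigma> rule: rev_induct)
    case Nil
    then show ?case using avoids_Nil[OF assms(1)] by simp
  next
    case (snoc a \<sigma>)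
    show ?case
    proof (cases "avoids \<sigma> \<tau>")
      case True
      then have "\<sigma> @ [a] \<in> first_hit \<tau>" using snoc.prems by (simp add: first_hit_def)
      then show ?thesis by blast
    next
      case False
      then show ?thesis using snoc.IH by fastforce
    qed
  qed
  then show thesis using that by blast
qed

section \<open>The greedy choice for packing occurrences\<close>

lemma nonoverlapping_iff:
  assumes "\<tau> \<noteq> []" "i < j"
  shows "nonoverlapping \<tau> i j \<longleftrightarrow> i + length \<tau> \<le> j"
    and "nonoverlapping \<tau> j i \<longleftrightarrow> i + length \<tau> \<le> j"
proof -
  have "j \<in> {i..<i + length \<tau>} \<inter> {j..<j + length \<tau>}" if "\<not> i + length \<tau> \<le> j"
    using that assms by (cases \<tau>) auto
  then show 1: "nonoverlapping \<tau> i j \<longleftrightarrow> i + length \<tau> \<le> j"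
    unfolding nonoverlapping_def by fastforce
  have "nonoverlapping \<tau> j i \<longleftrightarrow> nonoverlapping \<tau> i j"
    by (simp add: nonoverlapping_def Int_commute)
  then show "nonoverlapping \<tau> j i \<longleftrightarrow> i + length \<tau> \<le> j"
    using 1 by simp
qed

definition packing :: "'p::order list \<Rightarrow> nat list \<Rightarrow> nat set \<Rightarrow> bool" where
  "packing \<tau> \<sigma> S \<longleftrightarrow> S \<subseteq> {i. occurs_at \<tau> \<sigma> i} \<and> pairwise (nonoverlapping \<tau>) S"

lemma finite_occurrences: "finite {i. occurs_at \<tau> \<sigma> i}"
  by (rule finite_subset[of _ "{..length \<sigma>}"]) (auto simp: occurs_at_def)

lemma finite_packing: "packing \<tau> \<sigma> S \<Longrightarrow> finite S"
  unfolding packing_def using finite_occurrences finite_subset by blast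

lemma nlap_eq_Max: "nlap \<tau> \<sigma> = Max (card ` {S. packing \<tau> \<sigma> S})"
  unfolding nlap_def packing_def by (rule arg_cong[where f = Max]) auto

lemma finite_packings: "finite {S. packing \<tau> \<sigma> S}"
  by (rule finite_subset[of _ "Pow {i. occurs_at \<tau> \<sigma> i}"])
    (auto simp: packing_def finite_occurrences)

lemma card_packing_le_nlap: "packing \<tau> \<sigma> S \<Longrightarrow> card S \<le> nlap \<tau> \<sigma>"
  unfolding nlap_eq_Max using finite_packings by (intro Max_ge) auto

lemma obtain_maximum_packing:
  obtains S where "packing \<tau> \<sigma> S" "card S = nlap \<tau> \<sigma>"
proof -
  have "packing \<tau> \<sigma> {}" by (simp add: packing_def)
  then have "nlap \<tau> \<sigma> \<in> card ` {S. packing \<tau> \<sigma> S}"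
    unfolding nlap_eq_Max using finite_packings by (intro Max_in) auto
  then show thesis using that by auto
qed

lemma nlap_avoids: "avoids \<sigma> \<tau> \<Longrightarrow> nlap \<tau> \<sigma> = 0"
  by (rule obtain_maximum_packing[of \<tau> \<sigma>]) (auto simp: packing_def avoids_def)

text \<open>
  A packing of \<open>v\<close>, shifted, extends by the occurrence at the end of \<open>u\<close>.  Conversely, in any packing
  of \<open>u @ v\<close> the leftmost occurrence ends no earlier than \<open>u\<close> does, so all others lie inside \<open>v\<close>.
\<close>

lemma nlap_first_hit_append:
  assumes "\<tau> \<noteq> []" "u \<in> first_hit \<tau>"
  shows "nlap \<tau> (u @ v) = Suc (nlap \<tau> v)"
proof (rule antisym)
  obtain S where S: "packing \<tau> (u @ v) S" and card: "card S = nlap \<tau> (u @ v)"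
    by (rule obtain_maximum_packing)
  note fin = finite_packing[OF S]
  show "nlap \<tau> (u @ v) \<le> Suc (nlap \<tau> v)"
  proof (cases "S = {}")
    case True
    then show ?thesis using card by simp
  next
    case False
    \<comment> \<open>\<open>k\<close> is traded for the occurrence in \<open>u\<close>; \<open>S'\<close> is the rest, shifted to positions of \<open>v\<close>.\<close>
    define k where "k = Min S"
    define S' where "S' = {i. length u + i \<in> S - {k}}"
    have k: "k \<in> S" using fin False by (simp add: k_def)
    then have "length u \<le> k + length \<tau>"
      using S first_hit_occurrence_end[OF assms(2)] by (auto simp: packing_def)
    moreover have "k + length \<tau> \<le> j" if "j \<in> S - {k}" for j
    proof -
      have "k < j" using that fin by (simp add: k_def order_less_le)
      moreover have "nonoverlapping \<tau> k j"
        using S k that by (auto simp: packing_def pairwise_def)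
      ultimately show ?thesis using nonoverlapping_iff(1)[OF assms(1)] by blast
    qed
    ultimately have right: "length u \<le> j" if "j \<in> S - {k}" for j
      using that by fastforce
    have img: "(\<lambda>i. length u + i) ` S' = S - {k}"
    proof
      show "S - {k} \<subseteq> (\<lambda>i. length u + i) ` S'"
      proof
        fix j assume j: "j \<in> S - {k}"
        then have "j = length u + (j - length u)" using right by simp
        then show "j \<in> (\<lambda>i. length u + i) ` S'" using j unfolding S'_def by auto
      qed
    qed (auto simp: S'_def)
    have "packing \<tau> v S'"
      unfolding packing_def
    proof
      show "S' \<subseteq> {i. occurs_at \<tau> v i}"
        using S by (auto simp: S'_def packing_def occurs_at_append_right)
      show "pairwise (nonoverlapping \<tau>) S'"
      proof (rule pairwiseI)
        fix i j assume "i \<in> S'" "j \<in> S'" "i \<noteq> j"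
        then have "nonoverlapping \<tau> (length u + i) (length u + j)"
          using S by (auto simp: S'_def packing_def pairwise_def)
        then show "nonoverlapping \<tau> i j"
          using \<open>i \<noteq> j\<close> nonoverlapping_iff[OF assms(1)]
          by (cases i j rule: linorder_cases) auto
      qed
    qed
    then have "card S' \<le> nlap \<tau> v" by (rule card_packing_le_nlap)
    moreover have "card S' = card (S - {k})"
      unfolding img[symmetric] by (simp add: card_image)
    ultimately show ?thesis using card k fin by simp
  qed
next
  obtain S where S: "packing \<tau> v S" and card: "card S = nlap \<tau> v"
    by (rule obtain_maximum_packing)
  obtain k where k: "occurs_at \<tau> u k" "k + length \<tau> = length u"
    using first_hit_occurs_at_end[OF assms(2)] .
  define S' where "S' = (\<lambda>i. length u + i) ` S"
  have "packing \<tau> (u @ v) (insert k S')"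
    unfolding packing_def
  proof
    have "occurs_at \<tau> (u @ v) k"
      using k occurs_at_append_left[of k \<tau> u v] by simp
    then show "insert k S' \<subseteq> {i. occurs_at \<tau> (u @ v) i}"
      using S by (auto simp: S'_def packing_def occurs_at_append_right)
    have "nonoverlapping \<tau> k j \<and> nonoverlapping \<tau> j k" if "j \<in> S'" for j
    proof -
      have "k + length \<tau> \<le> j" using that k(2) by (auto simp: S'_def)
      moreover from this have "k < j" using assms(1) by (cases \<tau>) auto
      ultimately show ?thesis using nonoverlapping_iff[OF assms(1)] by blast
    qed
    moreover have "nonoverlapping \<tau> (length u + i) (length u + j)"
      if "i \<in> S" "j \<in> S" "i \<noteq> j" for i j
    proof -
      have "nonoverlapping \<tau> i j" using S that by (auto simp: packing_def pairwise_def)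
      then show ?thesis
        using that(3) nonoverlapping_iff[OF assms(1)]
        by (cases i j rule: linorder_cases) auto
    qed
    ultimately show "pairwise (nonoverlapping \<tau>) (insert k S')"
      by (auto simp: pairwise_insert) (auto simp: pairwise_def S'_def)
  qed
  then have "card (insert k S') \<le> nlap \<tau> (u @ v)" by (rule card_packing_le_nlap)
  moreover have "k \<notin> S'" using k(2) assms(1) by (cases \<tau>) (auto simp: S'_def)
  moreover have "card S' = card S" by (simp add: S'_def card_image)
  moreover have "finite S'" using finite_packing[OF S] by (simp add: S'_def)
  ultimately show "Suc (nlap \<tau> v) \<le> nlap \<tau> (u @ v)" using card by simp
qed

section \<open>The two functional equations\<close>

lemma avoiding_gf_eq_gf: "avoiding_gf A \<tau> = gf A {\<sigma>. avoids \<sigma> \<tau>} (\<lambda>_. 1)"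
  by (intro fps_xyt_ext) (simp add: avoiding_gf_def gf_nth words_def Int_def)

lemma nlap_gf_eq_gf: "nlap_gf A \<tau> = gf A UNIV (\<lambda>\<sigma>. fps_X ^ nlap \<tau> \<sigma>)"
  by (intro fps_xyt_ext) (simp add: nlap_gf_def gf_nth words_def)

text \<open>
  Count the words that avoid \<open>\<tau>\<close> up to their last letter in two ways.  Building them by appending a
  letter gives \<open>C y P\<close>; sorting them by whether the last letter completes an occurrence gives
  \<open>(C - 1) + D\<close>.  The empty word, which has no last letter, is added to both sides.
\<close>

lemma gf_first_hit:
  assumes "finite A" "\<tau> \<noteq> []"
  shows "gf A (first_hit \<tau>) (\<lambda>_. 1) = (Y * (\<Sum>a\<in>A. X ^ a) - 1) * avoiding_gf A \<tau> + 1"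
proof -
  define Av where "Av = {\<sigma>. avoids \<sigma> \<tau>}"
  define E where "E = (\<lambda>(u, v). u @ v) ` (Av \<times> {\<sigma>. length \<sigma> = 1})"
  have E: "E = {\<sigma>. \<sigma> \<noteq> [] \<and> avoids (butlast \<sigma>) \<tau>}"
  proof
    show "E \<subseteq> {\<sigma>. \<sigma> \<noteq> [] \<and> avoids (butlast \<sigma>) \<tau>}"
      by (auto simp: E_def Av_def length_Suc_conv)
    show "{\<sigma>. \<sigma> \<noteq> [] \<and> avoids (butlast \<sigma>) \<tau>} \<subseteq> E"
    proof clarify
      fix \<sigma> assume "\<sigma> \<noteq> []" "avoids (butlast \<sigma>) \<tau>"
      then have "(butlast \<sigma>, [last \<sigma>]) \<in> Av \<times> {\<sigma>. length \<sigma> = 1}" "\<sigma> = butlast \<sigma> @ [last \<sigma>]"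
        by (simp_all add: Av_def)
      then show "\<sigma> \<in> E" unfolding E_def by (metis (mono_tags, lifting) case_prod_conv image_eqI)
    qed
  qed
  have nil: "[] \<in> Av" "[] \<notin> first_hit \<tau>"
    using avoids_Nil[OF assms(2)] by (auto simp: Av_def first_hit_def)
  have prefix: "avoids (butlast \<sigma>) \<tau>" if "avoids \<sigma> \<tau>" for \<sigma>
    using that avoids_prefix[of "butlast \<sigma>" "[last \<sigma>]" \<tau>] by (cases "\<sigma> = []") auto
  have split: "E \<union> {[]} = Av \<union> first_hit \<tau>"
    using nil prefix by (auto simp: E Av_def first_hit_def)
  have "inj_on (\<lambda>(u, v). u @ v) (Av \<times> {\<sigma>. length \<sigma> = 1})"
    by (auto simp: inj_on_def)
  then have "gf A E (\<lambda>_. 1) = avoiding_gf A \<tau> * (Y * (\<Sum>a\<in>A. X ^ a))"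
    unfolding E_def avoiding_gf_eq_gf gf_letters[OF assms(1), symmetric] Av_def
    by (intro gf_concat[OF assms(1)]) auto
  moreover have "gf A (E \<union> {[]}) (\<lambda>_. 1) = gf A E (\<lambda>_. 1) + 1"
    using gf_Un_disjoint[OF assms(1), of E "{[]}"] by (simp add: E gf_empty_word)
  moreover have "gf A (Av \<union> first_hit \<tau>) (\<lambda>_. 1) = avoiding_gf A \<tau> + gf A (first_hit \<tau>) (\<lambda>_. 1)"
    unfolding avoiding_gf_eq_gf Av_def
    by (intro gf_Un_disjoint[OF assms(1)]) (auto simp: first_hit_def)
  ultimately show ?thesis
    using split by (simp add: algebra_simps)
qed

text \<open>
  Cutting a word at the end of its first completed occurrence splits off a first-hit word; the prefix
  code property makes the cut unique, and the factor \<open>t\<close> records the one occurrence used up.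
\<close>

lemma nlap_gf_recurrence:
  assumes "finite A" "\<tau> \<noteq> []"
  shows "nlap_gf A \<tau> = avoiding_gf A \<tau> + T * gf A (first_hit \<tau>) (\<lambda>_. 1) * nlap_gf A \<tau>"
proof -
  define Av where "Av = {\<sigma>. avoids \<sigma> \<tau>}"
  define H where "H = (\<lambda>(u, v). u @ v) ` (first_hit \<tau> \<times> UNIV)"
  let ?w = "\<lambda>\<sigma>. fps_X ^ nlap \<tau> \<sigma> :: rat fps"
  have "UNIV = Av \<union> H"
  proof -
    have "\<sigma> \<in> H" if hit: "\<not> avoids \<sigma> \<tau>" for \<sigma>
    proof -
      obtain u v where "\<sigma> = u @ v" "u \<in> first_hit \<tau>"
        using obtain_first_hit_prefix[OF assms(2) hit] .
      then show ?thesis unfolding H_def by (intro image_eqI[where x = "(u, v)"]) auto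
    qed
    then show ?thesis by (auto simp: Av_def)
  qed
  moreover have "Av \<inter> H = {}"
    using avoids_prefix by (auto simp: Av_def H_def first_hit_def)
  ultimately have "nlap_gf A \<tau> = gf A Av ?w + gf A H ?w"
    unfolding nlap_gf_eq_gf using gf_Un_disjoint[OF assms(1)] by metis
  moreover have "gf A Av ?w = avoiding_gf A \<tau>"
    unfolding avoiding_gf_eq_gf Av_def by (rule gf_cong) (simp add: nlap_avoids)
  \<comment> \<open>\<open>fps_X * 1\<close> has the shape that \<open>gf_scale\<close> expects.\<close>
  moreover have "gf A H ?w = gf A (first_hit \<tau>) (\<lambda>_. fps_X * 1) * nlap_gf A \<tau>"
    unfolding H_def nlap_gf_eq_gf
    by (rule gf_concat[OF assms(1) inj_on_first_hit_append])
      (simp add: nlap_first_hit_append[OF assms(2)])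
  moreover have "gf A (first_hit \<tau>) (\<lambda>_. fps_X * 1) = T * gf A (first_hit \<tau>) (\<lambda>_. 1)"
    unfolding T_def by (rule gf_scale)
  ultimately show ?thesis by simp
qed

text \<open>
  Positivity of the parts leaves the empty word as the only composition of 0, which makes the constant
  coefficient in \<open>x\<close> of the denominator equal to 1 and the division exact.
\<close>

lemma avoiding_gf_nth_0:
  assumes "\<forall>a\<in>A. a > 0" "\<tau> \<noteq> []"
  shows "avoiding_gf A \<tau> $ 0 = 1"
proof (rule fps_ext)
  fix m
  have "{\<sigma> \<in> compositions A 0 m. avoids \<sigma> \<tau>} = (if m = 0 then {[]} else {})"
  proof -
    have "\<sigma> = []" if "\<sigma> \<in> compositions A 0 m" for \<sigma>
      using that assms(1) by (cases \<sigma>) (auto simp: compositions_def)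
    moreover have "[] \<in> compositions A 0 m \<longleftrightarrow> m = 0"
      by (auto simp: compositions_def)
    ultimately show ?thesis using avoids_Nil[OF assms(2)] by auto
  qed
  then show "avoiding_gf A \<tau> $ 0 $ m = 1 $ m"
    by (simp add: avoiding_gf_def)
qed

theorem theorem4p1:
  fixes A :: "nat set" and \<tau> :: "'p::order list"
  assumes "finite A" and "\<forall>a\<in>A. a > 0" and "\<tau> \<noteq> []"
  shows "nlap_gf A \<tau> =
    avoiding_gf A \<tau> /
      (1 - T * ((Y * (\<Sum>a\<in>A. X ^ a) - 1) * avoiding_gf A \<tau> + 1))"
proof -
  define D where "D = (Y * (\<Sum>a\<in>A. X ^ a) - 1) * avoiding_gf A \<tau> + 1"
  have "nlap_gf A \<tau> = avoiding_gf A \<tau> + T * D * nlap_gf A \<tau>"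
    using nlap_gf_recurrence[OF assms(1,3)] gf_first_hit[OF assms(1,3)] by (simp add: D_def)
  then have "nlap_gf A \<tau> * (1 - T * D) = avoiding_gf A \<tau>"
    by (simp add: algebra_simps)
  moreover have unit: "(1 - T * D) $ 0 = 1"
  proof -
    have "(\<Sum>a\<in>A. X ^ a) $ 0 = 0"
      using assms(2) by (auto simp: X_def fps_sum_nth fps_X_power_nth intro!: sum.neutral)
    then have "D $ 0 = 0"
      using avoiding_gf_nth_0[OF assms(2,3)] by (simp add: D_def)
    then show ?thesis by simp
  qed
  ultimately have "avoiding_gf A \<tau> / (1 - T * D) * (1 - T * D) = nlap_gf A \<tau> * (1 - T * D)"
    using fps_xyt_divide_exact[OF unit] by simp
  moreover have "1 - T * D \<noteq> 0" using unit by force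
  ultimately show ?thesis by (simp add: D_def)
qed

end
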